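(* Let $G$ be a finite digraph containing a directed cycle $v_1\to v_2\to\dots\to v_m\to v_1$ with $m$ odd, and let $P$ be a poset with $|P|<3$. Then for every $k\ge 1$, there is no $P$-coloring of the $k$-walks of $G$.
   Context: A digraph has finite vertex set and edges that are ordered pairs of distinct vertices; write $u\to v$ for an edge. A $k$-walk is a sequence $(v_1\dots v_k)$ with $v_1\to\dots\to v_k$. A $P$-coloring of the $k$-walks is a map $c$ from $k$-walks to $P$ with $c(v_1\dots v_k)\not\le c(v_2\dots v_{k+1})$ for every $(k+1)$-walk $(v_1\dots v_{k+1})$. *)

theory Defs
  imports "Graph_Theory.Pair_Digraph" "Graph_Theory.Vertex_Walk"
begin

text \<open>The index \<open>k\<close> of a \<open>k\<close>-walk counts vertices, whereas \<^const>\<open>vwalk_length\<close> counts arcs.\<close>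

definition k_walks :: "('a, 'b) pre_digraph \<Rightarrow> nat \<Rightarrow> 'a vwalk set" where
  "k_walks G k = {w. vwalk w G \<and> length w = k}"

text \<open>The poset has carrier \<open>P\<close> and order relation \<open>r\<close>. For a \<open>(k+1)\<close>-walk
  \<open>w\<close>, \<open>butlast w\<close> and \<open>tl w\<close> are its first and last \<open>k\<close>-walk. Values
  of \<open>c\<close> outside the \<open>k\<close>-walks are irrelevant.\<close>

definition poset_coloring ::
    "('a, 'b) pre_digraph \<Rightarrow> nat \<Rightarrow> 'p set \<Rightarrow> 'p rel \<Rightarrow> ('a vwalk \<Rightarrow> 'p) \<Rightarrow> bool" where
  "poset_coloring G k P r c \<longleftrightarrow>
     (\<forall>w \<in> k_walks G k. c w \<in> P) \<and>
     (\<forall>w \<in> k_walks G (k + 1). (c (butlast w), c (tl w)) \<notin> r)"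

end

(* The k-walks winding around the cycle form a closed sequence of odd period.
   Reflexivity of the order makes consecutive members receive different colors,
   so at most two colors would have to alternate along an odd period. *)

theory Submission
  imports Defs
begin

lemma (in pre_digraph) cas_nth_consecutive:
  assumes "cas u p v" "Suc i < length p"
  shows "head G (p ! i) = tail G (p ! Suc i)"
  using assms
proof (induction u p v arbitrary: i rule: cas.induct)
  case (2 u e es v)
  then show ?case by (cases i) (auto simp: cas_simp hd_conv_nth)
qed simp

lemma (in pre_digraph) cas_head_last:
  assumes "cas u p v" "p \<noteq> []"
  shows "head G (last p) = v"
  using assms by (induction u p v rule: cas.induct) auto

text \<open>Inside \<open>p\<close>, the head of each arc is the tail of the next. At the
  wrap-around, the last arc ends in \<open>u\<close>, where the first arc starts. Reducing indices
  modulo \<open>length p\<close> thus unrolls the closed walk into an infinite one.\<close>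

lemma (in pre_digraph) closed_awalk_periodic_tails:
  assumes "awalk u p u" "p \<noteq> []"
  shows "tail G (p ! (i mod length p)) \<rightarrow> tail G (p ! (Suc i mod length p))"
proof -
  let ?n = "i mod length p"
  have cas: "cas u p u" and arc: "p ! ?n \<in> arcs G"
    using assms by (auto simp: awalk_def)
  have "head G (p ! ?n) = tail G (p ! (Suc i mod length p))"
  proof (cases "Suc ?n = length p")
    case True
    then have "?n = length p - 1" by simp
    then have "p ! ?n = last p" using assms(2) by (simp only: last_conv_nth not_False_eq_True)
    moreover have "Suc i mod length p = 0" using True by (simp add: mod_Suc)
    ultimately show ?thesis
      using cas assms(2) cas_head_last[OF cas] by (simp add: cas_simp hd_conv_nth)
  next
    case False
    moreover have "?n < length p" using assms(2) by simp
    ultimately show ?thesis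
      using cas_nth_consecutive[OF cas, of ?n] by (simp add: mod_Suc)
  qed
  then show ?thesis using arc by (auto simp: arcs_ends_conv)
qed

text \<open>Cuts finite windows out of an infinite walk. The window has \<open>Suc k\<close>
  vertices because a \<open>vwalk\<close> is never empty.\<close>

lemma (in wf_digraph) vwalk_map_upt:
  assumes "\<And>i. f i \<rightarrow> f (Suc i)"
  shows "vwalk (map f [i..<i + Suc k]) G"
proof (induction k arbitrary: i)
  case 0
  have "f i \<in> verts G" using assms adj_in_verts(1) by blast
  then show ?case by (auto simp: vwalk_def)
next
  case (Suc k)
  have "map f [i..<i + Suc (Suc k)] = f i # map f [Suc i..<Suc i + Suc k]"
    by (subst upt_conv_Cons) auto
  moreover have "hd (map f [Suc i..<Suc i + Suc k]) = f (Suc i)"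
    by (subst upt_conv_Cons) auto
  ultimately show ?case
    using vwalk_consI[OF Suc.IH[of "Suc i"]] assms adj_in_verts(1) by metis
qed

text \<open>With fewer than three values available, \<open>h (i + 2)\<close> must avoid
  \<open>h (i + 1)\<close> and hence falls back to \<open>h i\<close>; so \<open>h\<close> is
  constant on even indices.\<close>

lemma no_proper_two_coloring_odd_period:
  fixes h :: "nat \<Rightarrow> 'p"
  assumes P: "finite P" "card P < 3" "\<And>i. h i \<in> P"
    and proper: "\<And>i. h i \<noteq> h (Suc i)"
    and odd_period: "odd m" "h m = h 0"
  shows False
proof -
  have step: "h (Suc (Suc i)) = h i" for i
  proof (rule ccontr)
    assume "h (Suc (Suc i)) \<noteq> h i"
    then have "card {h i, h (Suc i), h (Suc (Suc i))} = 3"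
      using proper[of i] proper[of "Suc i"] by auto
    moreover have "card {h i, h (Suc i), h (Suc (Suc i))} \<le> card P"
      using P by (intro card_mono) auto
    ultimately show False using P(2) by simp
  qed
  have even: "h (2 * j) = h 0" for j
    by (induction j) (simp_all add: step)
  obtain j where "m = Suc (2 * j)"
    using odd_period(1) by (auto elim: oddE)
  \<comment> \<open>Both \<open>h (2 * j)\<close> and its successor \<open>h m\<close> equal
    \<open>h 0\<close>, against \<open>proper\<close>.\<close>
  then show False using even[of j] proper[of "2 * j"] odd_period(2) by simp
qed

theorem mainTheorem10:
  fixes G :: "'a pair_pre_digraph"
    and p :: "('a \<times> 'a) awalk"
    and P :: "'p set"
    and r :: "'p rel"
    and k :: nat
  assumes "pair_digraph G"
    and "pre_digraph.cycle (with_proj G) p"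
    and "odd (length p)"
    and "partial_order_on P r"
    and "finite P"
    and "card P < 3"
    and "k \<ge> 1"
  shows "\<not> (\<exists>c :: 'a vwalk \<Rightarrow> 'p. poset_coloring (with_proj G) k P r c)"
proof
  interpret pair_digraph G by fact
  assume "\<exists>c :: 'a vwalk \<Rightarrow> 'p. poset_coloring (with_proj G) k P r c"
  then obtain c :: "'a vwalk \<Rightarrow> 'p" where c: "poset_coloring (with_proj G) k P r c" ..
  obtain u where p: "awalk u p u" "p \<noteq> []"
    using assms(2) by (auto simp: cycle_def)
  \<comment> \<open>In a pair digraph the tail of an arc is its first component. The index is
    periodic, so a window may wind around the cycle several times when \<open>k\<close> exceeds
    \<open>length p\<close>.\<close>
  define f where "f i = fst (p ! (i mod length p))" for i
  have adj: "f i \<rightarrow>\<^bsub>with_proj G\<^esub> f (Suc i)" for i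
    using closed_awalk_periodic_tails[OF p, of i] by (simp add: f_def)
  have walk: "vwalk (map f [i..<i + Suc j]) (with_proj G)" for i j
    using adj by (intro vwalk_map_upt) simp
  define w where "w i = map f [i..<i + k]" for i
  have w: "w i \<in> k_walks (with_proj G) k" for i
    using walk[of i "k - 1"] \<open>k \<ge> 1\<close> by (simp add: k_walks_def w_def del: upt_Suc)
  have ext: "map f [i..<i + Suc k] \<in> k_walks (with_proj G) (k + 1)" for i
    using walk[of i k] by (simp add: k_walks_def del: upt_Suc)
  \<comment> \<open>The two \<open>k\<close>-walks inside a window of \<open>k + 1\<close> vertices
    are consecutive members of \<open>w\<close>, so the coloring condition compares exactly
    these.\<close>
  have "butlast (map f [i..<i + Suc k]) = w i" for i
    by (simp add: w_def)
  moreover have "tl (map f [i..<i + Suc k]) = w (Suc i)" for i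
    by (simp add: w_def map_tl[symmetric] del: upt_Suc)
  ultimately have "(c (w i), c (w (Suc i))) \<notin> r" for i
    using c ext[of i] unfolding poset_coloring_def by metis
  moreover have in_P: "c (w i) \<in> P" for i
    using c w by (auto simp: poset_coloring_def)
  moreover have "refl_on P r"
    using assms(4) by (simp add: partial_order_on_def preorder_on_def)
  ultimately have proper: "c (w i) \<noteq> c (w (Suc i))" for i
    by (metis refl_onD)
  \<comment> \<open>Shifting a window by \<open>length p\<close> leaves each of its vertices
    unchanged, whatever its length.\<close>
  have "w (length p) = w 0"
    unfolding w_def by (rule nth_equalityI) (auto simp: f_def)
  then show False
    using no_proper_two_coloring_odd_period[of P "\<lambda>i. c (w i)" "length p"]
      assms(3,5,6) in_P proper by simp
qed

end
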